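(* Let $\tau$ be a definable field topology on an NIP expansion of a field. Then $\tau$ is locally bounded.
   Context: A field topology on a field $K$ is a Hausdorff, non-discrete topology on $K$ for which the field operations (including division) are continuous. An NIP expansion of a field is a first-order structure $(K,+,\cdot,\ldots)$ expanding a field $(K,+,\cdot)$ whose complete theory is NIP. "Definable" means definable with parameters. A topology on a definable set is definable if some uniformly definable family of sets is a basis of open sets. A set $B \subseteq K$ is bounded (with respect to $\tau$) if for every neighborhood $U$ of $0$ there is some non-zero $c \in K$ with $cB \subseteq U$. The topology $\tau$ is locally bounded if some neighborhood of $0$ is bounded. *)

theory Defs
  imports "HOL-Analysis.Analysis"
begin

section \<open>First-order languages and structures\<close>

text \<open>The domains of the two arity maps are the symbols of the language, so that either kind of
  symbol may be absent. Constants are function symbols of arity 0; equality is a logical symbol.\<close>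

record ('f, 'r) fo_language =
  fun_arity :: "'f \<Rightarrow> nat option"
  rel_arity :: "'r \<Rightarrow> nat option"

datatype 'f fo_term = Var nat | Fun 'f "'f fo_term list"

datatype ('f, 'r) fo_formula =
    Eq "'f fo_term" "'f fo_term"
  | Rel 'r "'f fo_term list"
  | Neg "('f, 'r) fo_formula"
  | Conj "('f, 'r) fo_formula" "('f, 'r) fo_formula"
  | Ex nat "('f, 'r) fo_formula"

primrec wf_term :: "('f, 'r) fo_language \<Rightarrow> 'f fo_term \<Rightarrow> bool" where
  "wf_term L (Var v) = True"
| "wf_term L (Fun f ts) = (fun_arity L f = Some (length ts) \<and> list_all (wf_term L) ts)"

primrec wf_formula :: "('f, 'r) fo_language \<Rightarrow> ('f, 'r) fo_formula \<Rightarrow> bool" where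
  "wf_formula L (Eq s t) = (wf_term L s \<and> wf_term L t)"
| "wf_formula L (Rel r ts) = (rel_arity L r = Some (length ts) \<and> list_all (wf_term L) ts)"
| "wf_formula L (Neg \<phi>) = wf_formula L \<phi>"
| "wf_formula L (Conj \<phi> \<psi>) = (wf_formula L \<phi> \<and> wf_formula L \<psi>)"
| "wf_formula L (Ex v \<phi>) = wf_formula L \<phi>"

primrec vars_term :: "'f fo_term \<Rightarrow> nat set" where
  "vars_term (Var v) = {v}"
| "vars_term (Fun f ts) = \<Union> (set (map vars_term ts))"

primrec free_vars :: "('f, 'r) fo_formula \<Rightarrow> nat set" where
  "free_vars (Eq s t) = vars_term s \<union> vars_term t"
| "free_vars (Rel r ts) = \<Union> (vars_term ` set ts)"
| "free_vars (Neg \<phi>) = free_vars \<phi>"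
| "free_vars (Conj \<phi> \<psi>) = free_vars \<phi> \<union> free_vars \<psi>"
| "free_vars (Ex v \<phi>) = free_vars \<phi> - {v}"

text \<open>A structure has the whole type \<open>'a\<close> as its universe. Well-formed formulas only evaluate the
  interpretation of a symbol of the language on lists whose length is the arity of the symbol.\<close>

record ('f, 'r, 'a) fo_structure =
  fun_interp :: "'f \<Rightarrow> 'a list \<Rightarrow> 'a"
  rel_interp :: "'r \<Rightarrow> 'a list \<Rightarrow> bool"

primrec eval_term :: "('f, 'r, 'a) fo_structure \<Rightarrow> (nat \<Rightarrow> 'a) \<Rightarrow> 'f fo_term \<Rightarrow> 'a" where
  "eval_term M e (Var v) = e v"
| "eval_term M e (Fun f ts) = fun_interp M f (map (eval_term M e) ts)"

primrec sat :: "('f, 'r, 'a) fo_structure \<Rightarrow> (nat \<Rightarrow> 'a) \<Rightarrow> ('f, 'r) fo_formula \<Rightarrow> bool" where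
  "sat M e (Eq s t) = (eval_term M e s = eval_term M e t)"
| "sat M e (Rel r ts) = rel_interp M r (map (eval_term M e) ts)"
| "sat M e (Neg \<phi>) = (\<not> sat M e \<phi>)"
| "sat M e (Conj \<phi> \<psi>) = (sat M e \<phi> \<and> sat M e \<psi>)"
| "sat M e (Ex v \<phi>) = (\<exists>x. sat M (e(v := x)) \<phi>)"

definition formula_in :: "('f, 'r) fo_language \<Rightarrow> nat \<Rightarrow> ('f, 'r) fo_formula \<Rightarrow> bool" where
  "formula_in L n \<phi> \<longleftrightarrow> wf_formula L \<phi> \<and> free_vars \<phi> \<subseteq> {..<n}"

text \<open>The tuple \<open>as\<close> is substituted for the variables \<open>0, \<dots>, length as - 1\<close>. This is only used
  when those include all free variables, so that \<open>(!)\<close> out of range is irrelevant.\<close>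

definition holds :: "('f, 'r, 'a) fo_structure \<Rightarrow> ('f, 'r) fo_formula \<Rightarrow> 'a list \<Rightarrow> bool" where
  "holds M \<phi> as \<longleftrightarrow> sat M (\<lambda>i. as ! i) \<phi>"

definition tuples :: "nat \<Rightarrow> 'a list set" where
  "tuples n = {as. length as = n}"


section \<open>Complete theories and NIP\<close>

definition complete_theory ::
    "('f, 'r) fo_language \<Rightarrow> ('f, 'r, 'a) fo_structure \<Rightarrow> ('f, 'r) fo_formula set" where
  "complete_theory L M = {\<phi>. formula_in L 0 \<phi> \<and> holds M \<phi> []}"

definition is_model :: "('f, 'r, 'a) fo_structure \<Rightarrow> ('f, 'r) fo_formula set \<Rightarrow> bool" where
  "is_model M T \<longleftrightarrow> (\<forall>\<phi>\<in>T. holds M \<phi> [])"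

text \<open>\<open>\<phi>(x;y)\<close> is a partitioned formula in which \<open>x\<close> consists of the first \<open>m\<close> variables and \<open>y\<close> of
  the next \<open>k\<close>.\<close>

definition shattered ::
    "('f, 'r, 'a) fo_structure \<Rightarrow> ('f, 'r) fo_formula \<Rightarrow> nat \<Rightarrow> nat \<Rightarrow> 'a list set \<Rightarrow> bool" where
  "shattered M \<phi> m k A \<longleftrightarrow> A \<subseteq> tuples m \<and>
     (\<forall>S\<subseteq>A. \<exists>b\<in>tuples k. \<forall>a\<in>A. holds M \<phi> (a @ b) \<longleftrightarrow> a \<in> S)"

text \<open>A theory is NIP if no formula \<open>\<phi>(x;y)\<close> has the independence property, that is, if for every
  \<open>\<phi>(x;y)\<close> there is \<open>n\<close> such that no model of the theory contains a shattered set of size \<open>n\<close>.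
  Models are taken on a given type \<open>'a\<close>. For the complete theory of a structure on \<open>'a\<close> this is no
  restriction: for fixed \<open>\<phi>\<close> and \<open>n\<close> the existence of a shattered set of size \<open>n\<close> is expressed by a
  single sentence, hence it holds either in all models (of any cardinality) or in none.\<close>

definition nip_theory ::
    "'a itself \<Rightarrow> ('f, 'r) fo_language \<Rightarrow> ('f, 'r) fo_formula set \<Rightarrow> bool" where
  "nip_theory (_ :: 'a itself) L T \<longleftrightarrow>
     (\<forall>\<phi> m k. formula_in L (m + k) \<phi> \<longrightarrow>
        (\<exists>n. \<forall>N :: ('f, 'r, 'a) fo_structure. is_model N T \<longrightarrow>
           \<not> (\<exists>A. finite A \<and> card A = n \<and> shattered N \<phi> m k A)))"


section \<open>Expansions of fields\<close>

text \<open>The language contains symbols for \<open>+\<close> and \<open>\<cdot>\<close>, interpreted as the operations of the field;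
  further symbols are arbitrary.\<close>

definition expands_field :: "('f, 'r) fo_language \<Rightarrow> ('f, 'r, 'a::field) fo_structure \<Rightarrow> bool" where
  "expands_field L M \<longleftrightarrow>
     (\<exists>p t. fun_arity L p = Some 2 \<and> (\<forall>x y. fun_interp M p [x, y] = x + y) \<and>
            fun_arity L t = Some 2 \<and> (\<forall>x y. fun_interp M t [x, y] = x * y))"

definition nip_expansion_of_field ::
    "('f, 'r) fo_language \<Rightarrow> ('f, 'r, 'a::field) fo_structure \<Rightarrow> bool" where
  "nip_expansion_of_field L M \<longleftrightarrow>
     expands_field L M \<and> nip_theory TYPE('a) L (complete_theory L M)"


section \<open>Definable sets and definable topologies\<close>

text \<open>Definability is with parameters; \<open>c\<close> is the tuple of parameters.\<close>

definition definable ::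
    "('f, 'r) fo_language \<Rightarrow> ('f, 'r, 'a) fo_structure \<Rightarrow> nat \<Rightarrow> 'a list set \<Rightarrow> bool" where
  "definable L M n X \<longleftrightarrow>
     (\<exists>\<phi> c. formula_in L (n + length c) \<phi> \<and> X = {a \<in> tuples n. holds M \<phi> (a @ c)})"

text \<open>A uniformly definable family of subsets of the universe: the fibres, over a definable index
  set \<open>D\<close> of \<open>k\<close>-tuples, of a definable set \<open>R\<close> of \<open>(1 + k)\<close>-tuples.\<close>

definition uniformly_definable_family ::
    "('f, 'r) fo_language \<Rightarrow> ('f, 'r, 'a) fo_structure \<Rightarrow> 'a set set \<Rightarrow> bool" where
  "uniformly_definable_family L M \<B> \<longleftrightarrow>
     (\<exists>k D R. definable L M k D \<and> definable L M (1 + k) R \<and> \<B> = (\<lambda>b. {x. x # b \<in> R}) ` D)"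

definition basis_of_opens :: "'a topology \<Rightarrow> 'a set set \<Rightarrow> bool" where
  "basis_of_opens \<tau> \<B> \<longleftrightarrow> openin \<tau> = arbitrary union_of (\<lambda>B. B \<in> \<B>)"

definition definable_topology ::
    "('f, 'r) fo_language \<Rightarrow> ('f, 'r, 'a) fo_structure \<Rightarrow> 'a topology \<Rightarrow> bool" where
  "definable_topology L M \<tau> \<longleftrightarrow>
     topspace \<tau> = UNIV \<and> (\<exists>\<B>. uniformly_definable_family L M \<B> \<and> basis_of_opens \<tau> \<B>)"


section \<open>Field topologies\<close>

definition field_topology :: "'a::field topology \<Rightarrow> bool" where
  "field_topology \<tau> \<longleftrightarrow>
     topspace \<tau> = UNIV \<and> Hausdorff_space \<tau> \<and> \<tau> \<noteq> discrete_topology UNIV \<and>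
     continuous_map (prod_topology \<tau> \<tau>) \<tau> (\<lambda>(x, y). x + y) \<and>
     continuous_map (prod_topology \<tau> \<tau>) \<tau> (\<lambda>(x, y). x - y) \<and>
     continuous_map (prod_topology \<tau> \<tau>) \<tau> (\<lambda>(x, y). x * y) \<and>
     continuous_map (prod_topology \<tau> (subtopology \<tau> (- {0}))) \<tau> (\<lambda>(x, y). x / y)"

definition neighborhood_of_zero :: "'a::field topology \<Rightarrow> 'a set \<Rightarrow> bool" where
  "neighborhood_of_zero \<tau> U \<longleftrightarrow> (\<exists>V. openin \<tau> V \<and> 0 \<in> V \<and> V \<subseteq> U)"

definition bounded_wrt :: "'a::field topology \<Rightarrow> 'a set \<Rightarrow> bool" where
  "bounded_wrt \<tau> B \<longleftrightarrow>
     (\<forall>U. neighborhood_of_zero \<tau> U \<longrightarrow> (\<exists>c. c \<noteq> 0 \<and> (\<lambda>x. c * x) ` B \<subseteq> U))"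

definition locally_bounded :: "'a::field topology \<Rightarrow> bool" where
  "locally_bounded \<tau> \<longleftrightarrow> (\<exists>U. neighborhood_of_zero \<tau> U \<and> bounded_wrt \<tau> U)"

end

theory Submission imports Defs
begin

text \<open>
  Suppose that no neighborhood of \<open>0\<close> is bounded. Then for every \<open>n\<close> there are \<open>n\<close> points \<open>b\<^sub>j\<close> and
  \<open>n\<close> neighborhoods of zero \<open>W\<^sub>j\<close> such that the subset sums \<open>b\<^sub>S = (\<Sum>i\<in>S. b\<^sub>i)\<close> satisfy
  \<open>b\<^sub>S \<in> W\<^sub>j \<longleftrightarrow> j \<notin> S\<close>, where every \<open>W\<^sub>j\<close> is a rescaling \<open>{x. a x \<in> B}\<close> of a basic open set \<open>B\<close>
  by some \<open>a \<noteq> 0\<close>. The rescaled basic open sets belong to one uniformly definable family, so a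
  single formula shatters arbitrarily large finite sets, against NIP.

  The points and sets are built so that \<open>b\<^sub>S \<in> W\<^sub>j\<close> whenever \<open>j \<notin> S\<close>, and \<open>b\<^sub>j \<notin> W\<^sub>j - W\<^sub>j\<close>. These
  two conditions are enough: if \<open>j \<in> S\<close>, then \<open>b\<^sub>S\<close> and \<open>b\<^bsub>S - {j}\<^esub>\<close> differ by \<open>b\<^sub>j\<close>, and the second
  lies in \<open>W\<^sub>j\<close>, so the first does not (lemma \<open>subset_sum_pattern_mem_iff\<close>). To add one more point
  and set, observe that the old sets only ask the new point to lie in a certain neighborhood \<open>P\<close> of
  zero. As \<open>P\<close> is unbounded, there is a neighborhood \<open>U\<close> of zero that contains no \<open>a P\<close> with
  \<open>a \<noteq> 0\<close>. Take \<open>B\<close> basic with \<open>0 \<in> B\<close> and \<open>B - B \<subseteq> U\<close>, and \<open>a \<noteq> 0\<close> so close to zero that it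
  moves all the old subset sums into \<open>B\<close>; such an \<open>a\<close> exists because the topology is not discrete.
  Then some \<open>p \<in> P\<close> has \<open>a p \<notin> U\<close>, hence \<open>p \<notin> W - W\<close> for \<open>W = {x. a x \<in> B}\<close>, and \<open>p\<close> and \<open>W\<close> are
  the new point and set (lemma \<open>unbounded_independent_neighborhoods\<close>).
\<close>

section \<open>Neighborhoods of zero in a field topology\<close>

lemma field_topology_openin_add_preimage:
  assumes "field_topology \<tau>" "openin \<tau> W"
  shows "openin \<tau> {x. s + x \<in> W}"
proof -
  have "continuous_map \<tau> \<tau> ((\<lambda>(x, y). x + y) \<circ> (\<lambda>x. (s, x)))"
    using assms(1) by (intro continuous_map_compose[of _ "prod_topology \<tau> \<tau>"])
      (auto simp: field_topology_def continuous_map_pairwise comp_def)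
  then show ?thesis
    using openin_continuous_map_preimage[OF _ assms(2)] assms(1)
    by (fastforce simp: field_topology_def comp_def)
qed

lemma field_topology_openin_mult_preimage:
  assumes "field_topology \<tau>" "openin \<tau> W"
  shows "openin \<tau> {x. x * s \<in> W}"
proof -
  have "continuous_map \<tau> \<tau> ((\<lambda>(x, y). x * y) \<circ> (\<lambda>x. (x, s)))"
    using assms(1) by (intro continuous_map_compose[of _ "prod_topology \<tau> \<tau>"])
      (auto simp: field_topology_def continuous_map_pairwise comp_def)
  then show ?thesis
    using openin_continuous_map_preimage[OF _ assms(2)] assms(1)
    by (fastforce simp: field_topology_def comp_def)
qed

lemma field_topology_difference_neighborhood:
  assumes "field_topology \<tau>" "openin \<tau> U" "0 \<in> U"
  obtains W where "openin \<tau> W" "0 \<in> W" "\<And>x y. x \<in> W \<Longrightarrow> y \<in> W \<Longrightarrow> x - y \<in> U"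
proof -
  have "openin (prod_topology \<tau> \<tau>) {z \<in> topspace (prod_topology \<tau> \<tau>). (\<lambda>(x, y). x - y) z \<in> U}"
    using assms by (intro openin_continuous_map_preimage[where Y = \<tau>]) (auto simp: field_topology_def)
  then have "openin (prod_topology \<tau> \<tau>) {(x, y). x - y \<in> U}"
    using assms(1) by (simp add: field_topology_def case_prod_unfold)
  then obtain V V' where "openin \<tau> V" "openin \<tau> V'" "0 \<in> V" "0 \<in> V'" "V \<times> V' \<subseteq> {(x, y). x - y \<in> U}"
    using assms(3) unfolding openin_prod_topology_alt by (smt (verit) case_prodI diff_zero mem_Collect_eq)
  then show thesis
    by (intro that[of "V \<inter> V'"]) auto
qed

text \<open>An isolated zero would make every point isolated, by translation.\<close>

lemma field_topology_nonzero_in_neighborhood: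
  assumes "field_topology \<tau>" "openin \<tau> W" "0 \<in> W"
  obtains a where "a \<in> W" "a \<noteq> 0"
proof -
  have "W \<noteq> {0}"
  proof
    assume "W = {0}"
    then have "openin \<tau> {s}" for s
      using field_topology_openin_add_preimage[OF assms(1,2), of "- s"]
      by (simp add: add_eq_0_iff)
    then have "\<tau> = discrete_topology UNIV"
      using assms(1) by (intro discrete_topology_unique[THEN iffD2, THEN sym])
        (auto simp: field_topology_def)
    then show False
      using assms(1) by (simp add: field_topology_def)
  qed
  then show thesis
    using that assms(3) by auto
qed


section \<open>Independent neighborhoods in a topology that is not locally bounded\<close>

definition subset_sum_pattern ::
    "'a::field set set \<Rightarrow> nat \<Rightarrow> (nat \<Rightarrow> 'a) \<Rightarrow> (nat \<Rightarrow> 'a set) \<Rightarrow> (nat \<Rightarrow> 'a) \<Rightarrow> bool" where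
  "subset_sum_pattern \<B> n a B b \<longleftrightarrow>
     (\<forall>j<n. B j \<in> \<B>) \<and>
     (\<forall>j<n. \<forall>x y. a j * x \<in> B j \<longrightarrow> a j * y \<in> B j \<longrightarrow> b j \<noteq> x - y) \<and>
     (\<forall>S\<subseteq>{..<n}. \<forall>j<n. j \<notin> S \<longrightarrow> a j * sum b S \<in> B j)"

text \<open>Adding \<open>b\<^sub>j\<close> to a subset sum that does not contain it moves the sum out of the \<open>j\<close>-th set,
  because \<open>b\<^sub>j\<close> is not a difference of two members of that set.\<close>

lemma subset_sum_pattern_mem_iff:
  assumes "subset_sum_pattern \<B> n a B b" "S \<subseteq> {..<n}" "j < n"
  shows "a j * sum b S \<in> B j \<longleftrightarrow> j \<notin> S"
proof
  assume in_B: "a j * sum b S \<in> B j"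
  show "j \<notin> S"
  proof
    assume "j \<in> S"
    then have "b j = sum b S - sum b (S - {j})"
      using assms(2) finite_subset[of S "{..<n}"] by (simp add: sum.remove)
    moreover have "a j * sum b (S - {j}) \<in> B j"
      using assms unfolding subset_sum_pattern_def by (meson Diff_iff Diff_subset insertI1 order_trans)
    ultimately show False
      using assms(1,3) in_B unfolding subset_sum_pattern_def by blast
  qed
qed (use assms in \<open>simp add: subset_sum_pattern_def\<close>)

text \<open>The neighborhood that witnesses unboundedness changes at each step of the induction, and this
  is why the basic set \<open>B j\<close> varies together with the factor \<open>a j\<close>.\<close>

lemma unbounded_independent_neighborhoods:
  fixes \<tau> :: "'a::field topology" and n :: nat
  assumes ft: "field_topology \<tau>" and nlb: "\<not> locally_bounded \<tau>" and basis: "basis_of_opens \<tau> \<B>"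
  shows "\<exists>a B b. subset_sum_pattern \<B> n a B b"
proof (induction n)
  case 0
  show ?case by (simp add: subset_sum_pattern_def)
next
  case (Suc n)
  have B_open: "openin \<tau> B" if "B \<in> \<B>" for B
    using that basis unfolding basis_of_opens_def by (metis union_of_inc arbitrary_def)
  have B_basic: "\<exists>B\<in>\<B>. x \<in> B \<and> B \<subseteq> W" if "openin \<tau> W" "x \<in> W" for W x
    using that basis unfolding basis_of_opens_def union_of_def arbitrary_def by auto
  obtain a B b where pattern: "subset_sum_pattern \<B> n a B b"
    using Suc.IH by blast
  then have B: "B j \<in> \<B>" if "j < n" for j
    using that by (simp add: subset_sum_pattern_def)
  have diff: "b j \<noteq> x - y" if "j < n" "a j * x \<in> B j" "a j * y \<in> B j" for j x y
    using pattern that unfolding subset_sum_pattern_def by blast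
  have sums: "a j * sum b S \<in> B j" if "S \<subseteq> {..<n}" "j < n" "j \<notin> S" for S j
    using pattern that by (simp add: subset_sum_pattern_def)
  \<comment> \<open>A new point in \<open>P\<close> can be added to any old subset sum without leaving the old sets.\<close>
  define I where "I = Sigma {..<n} (\<lambda>j. Pow ({..<n} - {j}))"
  define P where "P = (\<Inter>(j, S)\<in>I. {x. a j * (sum b S + x) \<in> B j}) \<inter> topspace \<tau>"
  have finI: "finite I"
    by (auto simp: I_def)
  have "openin \<tau> {x. a j * (sum b S + x) \<in> B j}" if "j < n" for j S
    using field_topology_openin_add_preimage[OF ft
        field_topology_openin_mult_preimage[OF ft B_open[OF B[OF that]], of "a j"], of "sum b S"]
    by (simp add: mult.commute)
  then have "openin \<tau> P"
    unfolding P_def using finI by (intro openin_INT) (auto simp: I_def)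
  moreover have "0 \<in> P"
    using sums ft by (auto simp: P_def I_def field_topology_def subset_Diff_insert)
  ultimately have "\<not> bounded_wrt \<tau> P"
    using nlb unfolding locally_bounded_def neighborhood_of_zero_def by blast
  then obtain N where "neighborhood_of_zero \<tau> N" and N: "\<And>c. c \<noteq> 0 \<Longrightarrow> \<not> (\<lambda>x. c * x) ` P \<subseteq> N"
    by (auto simp: bounded_wrt_def)
  then obtain U where "openin \<tau> U" "0 \<in> U" "U \<subseteq> N"
    by (auto simp: neighborhood_of_zero_def)
  then obtain W where "openin \<tau> W" "0 \<in> W" and W: "\<And>x y. x \<in> W \<Longrightarrow> y \<in> W \<Longrightarrow> x - y \<in> U"
    using field_topology_difference_neighborhood[OF ft] by metis
  then obtain B' where B': "B' \<in> \<B>" "0 \<in> B'" "B' \<subseteq> W"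
    using B_basic by blast
  \<comment> \<open>\<open>Q\<close> consists of the factors that move all the old subset sums into the new basic set.\<close>
  define Q where "Q = (\<Inter>S\<in>Pow {..<n}. {c. c * sum b S \<in> B'})"
  have "openin \<tau> Q"
    unfolding Q_def using field_topology_openin_mult_preimage[OF ft B_open[OF B'(1)]]
    by (intro openin_INT2) auto
  moreover have "0 \<in> Q"
    using B'(2) by (simp add: Q_def)
  ultimately obtain c where c: "c \<in> Q" "c \<noteq> 0"
    using field_topology_nonzero_in_neighborhood[OF ft] by blast
  obtain p where p: "p \<in> P" "c * p \<notin> U"
    using N[OF c(2)] \<open>U \<subseteq> N\<close> by blast
  define a' B'' b' where new: "a' = a(n := c)" "B'' = B(n := B')" "b' = b(n := p)"
  have sum_old: "sum b' S = sum b S" if "S \<subseteq> {..<n}" for S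
    using that by (intro sum.cong) (auto simp: new)
  have "\<forall>x y. a' j * x \<in> B'' j \<longrightarrow> a' j * y \<in> B'' j \<longrightarrow> b' j \<noteq> x - y" if "j < Suc n" for j
  proof (cases "j = n")
    case True
    have "c * x - c * y \<in> U" if "c * x \<in> B'" "c * y \<in> B'" for x y
      using that B'(3) W by blast
    then show ?thesis
      using True p(2) by (auto simp: new right_diff_distrib)
  next
    case False
    then show ?thesis
      using that diff by (auto simp: new)
  qed
  moreover have "B'' j \<in> \<B>" if "j < Suc n" for j
    using that B B'(1) by (auto simp: new less_Suc_eq)
  moreover have "a' j * sum b' S \<in> B'' j" if S: "S \<subseteq> {..<Suc n}" and j: "j < Suc n" "j \<notin> S" for S j
  proof (cases "n \<in> S")
    case False
    then have "S \<subseteq> {..<n}"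
      using S by (auto simp: less_Suc_eq)
    then show ?thesis
      unfolding sum_old[OF \<open>S \<subseteq> {..<n}\<close>]
      using sums[of S j] c(1) j by (auto simp: new Q_def less_Suc_eq)
  next
    case True
    have S': "S - {n} \<subseteq> {..<n}"
      using S by (auto simp: less_Suc_eq)
    have "finite S"
      using S finite_subset by blast
    then have "sum b' S = p + sum b (S - {n})"
      using True sum.remove[of S n b'] sum_old[OF S'] by (simp add: new)
    moreover have "(j, S - {n}) \<in> I"
      using S' j True by (auto simp: I_def less_Suc_eq)
    ultimately show ?thesis
      using p(1) True j by (auto simp: P_def new add.commute)
  qed
  ultimately have "subset_sum_pattern \<B> (Suc n) a' B'' b'"
    by (simp add: subset_sum_pattern_def)
  then show ?case
    by blast
qed


section \<open>Definability of rescaled sets\<close>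

lemma eval_term_cong:
  "(\<And>v. v \<in> vars_term t \<Longrightarrow> e v = e' v) \<Longrightarrow> eval_term M e t = eval_term M e' t"
proof (induction t)
  case (Fun f ts)
  then have "map (eval_term M e) ts = map (eval_term M e') ts"
    by (intro map_cong) auto
  then show ?case by (simp only: eval_term.simps)
qed simp

lemma sat_cong:
  "(\<And>v. v \<in> free_vars \<phi> \<Longrightarrow> e v = e' v) \<Longrightarrow> sat M e \<phi> = sat M e' \<phi>"
proof (induction \<phi> arbitrary: e e')
  case (Eq s t)
  then show ?case
    using eval_term_cong[of s e e' M] eval_term_cong[of t e e' M] by simp
next
  case (Rel r ts)
  then have "map (eval_term M e) ts = map (eval_term M e') ts"
    by (intro map_cong eval_term_cong) auto
  then show ?case by (simp only: sat.simps)
next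
  case (Neg \<phi>)
  from Neg.IH[of e e'] Neg.prems show ?case
    by (simp only: sat.simps free_vars.simps)
next
  case (Conj \<phi> \<psi>)
  from Conj.IH(1)[of e e'] Conj.IH(2)[of e e'] Conj.prems show ?case
    by (simp only: sat.simps free_vars.simps Un_iff simp_thms)
next
  case (Ex v \<phi>)
  have "sat M (e(v := x)) \<phi> = sat M (e'(v := x)) \<phi>" for x
    by (rule Ex.IH) (use Ex.prems in simp)
  then show ?case by simp
qed

text \<open>Renaming variables in a formula would require care about capture by its quantifiers. The
  factor \<open>a\<close> therefore takes the place of the rescaled variable \<open>0\<close>, which a quantifier rebinds
  to the product after that product has been stored in a fresh variable; the parameters keep their
  places and the new variable \<open>x\<close> comes last.\<close>

lemma rescaled_formula:
  fixes M :: "('f, 'r, 'a::field) fo_structure"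
  assumes "expands_field L M" and \<psi>: "formula_in L (1 + k + l) \<psi>"
  obtains \<phi> where "formula_in L ((1 + k) + (l + 1)) \<phi>"
    and "\<And>a t c x. length t = k \<Longrightarrow> length c = l \<Longrightarrow>
           holds M \<phi> ((a # t) @ (c @ [x])) \<longleftrightarrow> holds M \<psi> ((a * x # t) @ c)"
proof -
  obtain f where f: "fun_arity L f = Some 2" "\<And>x y. fun_interp M f [x, y] = x * y"
    using assms(1) by (auto simp: expands_field_def)
  define q where "q = 1 + k + l"
  \<comment> \<open>Variable \<open>q\<close> stands for \<open>x\<close>, and \<open>Suc q\<close>, which is not free in \<open>\<psi>\<close>, holds the product.\<close>
  define \<phi> where "\<phi> = Ex (Suc q) (Conj (Eq (Var (Suc q)) (Fun f [Var 0, Var q]))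
    (Ex 0 (Conj (Eq (Var 0) (Var (Suc q))) \<psi>)))"
  show thesis
  proof
    show "formula_in L ((1 + k) + (l + 1)) \<phi>"
      using \<psi> f(1) by (auto simp: formula_in_def \<phi>_def q_def)
  next
    fix a x :: 'a and t c :: "'a list"
    assume len: "length t = k" "length c = l"
    define e where "e = (!) ((a # t) @ (c @ [x]))"
    have e: "e 0 = a" "e q = x" "q \<noteq> 0"
      using len by (auto simp: e_def q_def nth_append nth_Cons')
    have "holds M \<phi> ((a # t) @ (c @ [x])) \<longleftrightarrow> sat M (e(Suc q := a * x, 0 := a * x)) \<psi>"
      unfolding holds_def \<phi>_def e_def[symmetric] by (simp add: e f(2))
    also have "\<dots> \<longleftrightarrow> holds M \<psi> ((a * x # t) @ c)"
      unfolding holds_def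
    proof (rule sat_cong)
      fix v assume "v \<in> free_vars \<psi>"
      then have "v < q"
        using \<psi> by (auto simp: formula_in_def q_def)
      then show "(e(Suc q := a * x, 0 := a * x)) v = ((a * x # t) @ c) ! v"
        using len by (cases v) (auto simp: e_def q_def nth_append)
    qed
    finally show "holds M \<phi> ((a # t) @ (c @ [x])) \<longleftrightarrow> holds M \<psi> ((a * x # t) @ c)" .
  qed
qed


section \<open>Local boundedness\<close>

theorem theorem1p6:
  fixes L :: "('f, 'r) fo_language"
    and M :: "('f, 'r, 'a::field) fo_structure"
    and \<tau> :: "'a topology"
  assumes "nip_expansion_of_field L M"
    and "field_topology \<tau>"
    and "definable_topology L M \<tau>"
  shows "locally_bounded \<tau>"
proof (rule ccontr)
  assume nlb: "\<not> locally_bounded \<tau>"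
  obtain k D R \<B> where R: "definable L M (1 + k) R" and D: "definable L M k D"
    and \<B>: "\<B> = (\<lambda>t. {x. x # t \<in> R}) ` D" and basis: "basis_of_opens \<tau> \<B>"
    using assms(3) unfolding definable_topology_def uniformly_definable_family_def by blast
  obtain \<psi> c where \<psi>: "formula_in L (1 + k + length c) \<psi>"
    and R_eq: "R = {z \<in> tuples (1 + k). holds M \<psi> (z @ c)}"
    using R unfolding definable_def by blast
  have field: "expands_field L M"
    using assms(1) by (simp add: nip_expansion_of_field_def)
  obtain \<phi> where \<phi>: "formula_in L ((1 + k) + (length c + 1)) \<phi>"
    and \<phi>_iff: "\<And>a t x. length t = k \<Longrightarrow>
      holds M \<phi> ((a # t) @ (c @ [x])) \<longleftrightarrow> holds M \<psi> ((a * x # t) @ c)"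
    by (rule rescaled_formula[OF field \<psi>]) (rule that, assumption, simp only:)
  have "is_model M (complete_theory L M)"
    by (simp add: is_model_def complete_theory_def)
  moreover have "nip_theory TYPE('a) L (complete_theory L M)"
    using assms(1) by (simp add: nip_expansion_of_field_def)
  ultimately obtain n where n: "\<not> (\<exists>A. finite A \<and> card A = n \<and> shattered M \<phi> (1 + k) (length c + 1) A)"
    using nip_theory_def[THEN iffD1, THEN spec, THEN spec, THEN spec, THEN mp, OF _ \<phi>] by meson
  obtain a B b where pattern: "subset_sum_pattern \<B> n a B b"
    using unbounded_independent_neighborhoods[OF assms(2) nlb basis] by blast
  then have B: "B j \<in> \<B>" if "j < n" for j
    using that by (simp add: subset_sum_pattern_def)
  have "\<forall>j. \<exists>t. j < n \<longrightarrow> t \<in> D \<and> B j = {x. x # t \<in> R}"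
    using B \<B> by blast
  then obtain t where t: "\<And>j. j < n \<Longrightarrow> t j \<in> D" "\<And>j. j < n \<Longrightarrow> B j = {x. x # t j \<in> R}"
    by metis
  have len: "length (t j) = k" if "j < n" for j
    using t(1)[OF that] D by (auto simp: definable_def tuples_def)
  have holds_iff: "holds M \<phi> ((a j # t j) @ (c @ [sum b S])) \<longleftrightarrow> j \<notin> S"
    if "S \<subseteq> {..<n}" "j < n" for S j
    using subset_sum_pattern_mem_iff[OF pattern that] t(2)[OF that(2)] len[OF that(2)] \<phi>_iff
    by (simp add: R_eq tuples_def)
  \<comment> \<open>The shattered set consists of the codes of the neighborhoods, and the subset sums cut out its
    subsets; the parameters \<open>c\<close> go with the subset sums, as they are common to all the codes.\<close>
  define g where "g = (\<lambda>j. a j # t j)"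
  have "inj_on g {..<n}"
  proof (rule inj_onI)
    fix i j assume "i \<in> {..<n}" "j \<in> {..<n}" "g i = g j"
    then show "i = j"
      using holds_iff[of "{i}" i] holds_iff[of "{i}" j] by (auto simp: g_def)
  qed
  then have "card (g ` {..<n}) = n"
    by (simp add: card_image)
  moreover have "shattered M \<phi> (1 + k) (length c + 1) (g ` {..<n})"
    unfolding shattered_def
  proof (intro conjI allI impI)
    show "g ` {..<n} \<subseteq> tuples (1 + k)"
      using len by (auto simp: g_def tuples_def)
  next
    fix S assume "S \<subseteq> g ` {..<n}"
    \<comment> \<open>The complement, since \<open>b\<^sub>S\<close> lies in the \<open>j\<close>-th set exactly when \<open>j \<notin> S\<close>.\<close>
    define S' where "S' = {j. j < n \<and> g j \<notin> S}"
    have "holds M \<phi> (g j @ (c @ [sum b S'])) \<longleftrightarrow> g j \<in> S" if "j < n" for j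
      using holds_iff[of S' j] that by (auto simp: g_def S'_def)
    then show "\<exists>y\<in>tuples (length c + 1). \<forall>z\<in>g ` {..<n}. holds M \<phi> (z @ y) \<longleftrightarrow> z \<in> S"
      by (intro bexI[of _ "c @ [sum b S']"]) (auto simp: tuples_def)
  qed
  ultimately show False
    using n by blast
qed

end
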